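(* Let $\sigma(m)=\sum_{d\mid m} d$ for $m\in\mathbb{N}$ and $\sigma(y)=0$ for $y\notin\mathbb{N}$, and let $\bar g(n)=\sigma(n)-\sigma(n/2)$. Define $P_0(x)=1$, $P_n(x)=\frac{x}{n}\sum_{k=1}^{n}\bar g(k)P_{n-k}(x)$ for $n\geq1$, and $\Delta_n(x)=(P_n(x))^{n+1}-(P_{n+1}(x))^{n}$. Let $\bar p(n)$ be the number of overpartitions of $n$, so that $\sum_{n\geq0}\bar p(n)t^n=\prod_{m\geq1}\frac{1+t^m}{1-t^m}$ and $\bar p(n)=P_n(2)$. Then $\Delta_1(2)=\Delta_2(2)=0$, and for every $n\geq 3$, $$\bar p(n)^{n+1}>\bar p(n+1)^{n};$$ hence $\Delta_n(2)>0$ for all $n\geq3$.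
   Context: An overpartition of $n$ is a non-increasing sequence of positive integers summing to $n$ in which the last occurrence of each distinct part may be overlined. The polynomials satisfy $\sum_{n\geq0}P_n(x)t^n=\left(\prod_{m\geq1}\frac{1+t^m}{1-t^m}\right)^{x/2}$. *)

theory Defs
  imports
    "HOL-Analysis.Analysis"
    "HOL-Computational_Algebra.Computational_Algebra"
begin

(* The sum of divisors, extended by 0 to all reals that are not positive integers. *)
definition divisor_sum :: "real \<Rightarrow> real" where
  "divisor_sum y = (if y \<in> \<nat> \<and> y \<noteq> 0 then (\<Sum>d | d dvd nat \<lfloor>y\<rfloor>. real d) else 0)"

definition gbar :: "nat \<Rightarrow> real" where
  "gbar n = divisor_sum (real n) - divisor_sum (real n / 2)"

fun P_poly :: "nat \<Rightarrow> real poly" where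
  "P_poly 0 = 1"
| "P_poly (Suc n) = smult (1 / real (Suc n))
     ([:0, 1:] * (\<Sum>k = 1..Suc n. smult (gbar k) (P_poly (Suc n - k))))"

definition Delta :: "nat \<Rightarrow> real \<Rightarrow> real" where
  "Delta n x = poly (P_poly n) x ^ (n + 1) - poly (P_poly (n + 1)) x ^ n"

(* A part is a pair (size, overlined?).  Only the last occurrence of a size may be overlined. *)
definition overpartition :: "nat \<Rightarrow> (nat \<times> bool) list \<Rightarrow> bool" where
  "overpartition n ps \<longleftrightarrow>
     sorted_wrt (\<ge>) (map fst ps) \<and>
     (\<forall>p \<in> set ps. fst p > 0) \<and>
     sum_list (map fst ps) = n \<and>
     (\<forall>i < length ps. snd (ps ! i) \<longrightarrow>
        (\<forall>j. i < j \<and> j < length ps \<longrightarrow> fst (ps ! j) \<noteq> fst (ps ! i)))"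

definition pbar :: "nat \<Rightarrow> nat" where
  "pbar n = card {ps. overpartition n ps}"

end

(* Write P for the generating function of p(n) = P_n(2) and G for that of gbar, so that t P' = 2 G P.
   Multiplying by 1 - t and using that the second differences of p are nonnegative, bounds
   k (k + 1) <= 2 (gbar 1 + ... + gbar k) <= 7/5 k (k + 1) turn into
   (n + 2 u) / (n + 1) <= p(n + 1) / p(n) <= (n + 14/5 u) / (n + 1), u = (p(0) + ... + p(n)) / p(n).
   As u(n + 1) = 1 + u(n) p(n) / p(n + 1), these inequalities bound u(n) between multiples of sqrt n,
   and hence give p(n + 1) / p(n) <= exp (2 / sqrt n) while p(n) > exp (2 sqrt n) for n >= 36.
   Below 36 the claim follows from log-concavity of the first values.
   Overpartitions are counted by splitting off the largest part; the logarithmic derivative of the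
   partial products identifies their number with P_n(2). *)

theory Submission
  imports Defs
begin

unbundle fps_syntax

section \<open>Divisor sums\<close>

lemma divisor_sum_of_nat: "k > 0 \<Longrightarrow> divisor_sum (real k) = (\<Sum>d | d dvd k. real d)"
  by (simp add: divisor_sum_def)

text \<open>For even \<open>k\<close> the divisors of \<open>k / 2\<close> are exactly the divisors
  \<open>d\<close> of \<open>k\<close> with even cofactor \<open>k div d\<close>, so the subtraction
  removes these and keeps the odd cofactors.\<close>

lemma gbar_eq:
  assumes "k > 0"
  shows "gbar k = (\<Sum>d | d dvd k \<and> odd (k div d). real d)"
proof -
  have half: "divisor_sum (real k / 2) = (\<Sum>d | d dvd k \<and> even (k div d). real d)"
  proof (cases "even k")
    case True
    then obtain m where m: "k = 2 * m" by blast
    with assms have "m > 0" by simp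
    moreover have "{d. d dvd k \<and> even (k div d)} = {d. d dvd m}"
    proof (intro set_eqI iffI; clarsimp)
      fix d assume d: "d dvd k" "even (k div d)"
      then obtain c where "k div d = 2 * c" by blast
      with d(1) have "k = d * (2 * c)" by (metis dvd_mult_div_cancel)
      then show "d dvd m" by (simp add: m)
    next
      fix d assume "d dvd m"
      then obtain c where "m = d * c" by blast
      then show "d dvd k \<and> even (k div d)" using \<open>m > 0\<close> by (simp add: m)
    qed
    ultimately show ?thesis
      using divisor_sum_of_nat[of m] by (simp add: m)
  next
    case False
    \<comment> \<open>For odd \<open>k\<close> the half is not a natural number, so
      \<open>divisor_sum\<close> takes its default value 0, matching the absence of even
      cofactors.\<close>
    have "real k / 2 \<notin> \<nat>"
    proof
      assume "real k / 2 \<in> \<nat>"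
      then obtain m where "real k / 2 = real m" by (auto simp: Nats_def)
      then have "real k = real (2 * m)" by simp
      then have "k = 2 * m" by (simp only: of_nat_eq_iff)
      with False show False by simp
    qed
    moreover have none: "{d. d dvd k \<and> even (k div d)} = {}"
      using False by (metis (mono_tags, lifting) Collect_empty_eq dvd_mult_div_cancel even_mult_iff)
    ultimately show ?thesis unfolding none by (simp add: divisor_sum_def)
  qed
  have fin: "finite {d. d dvd k}" using assms by simp
  have "divisor_sum (real k)
      = (\<Sum>d\<in>{d. d dvd k \<and> odd (k div d)} \<union> {d. d dvd k \<and> even (k div d)}. real d)"
    unfolding divisor_sum_of_nat[OF assms] by (rule sum.cong) auto
  also have "\<dots> = (\<Sum>d | d dvd k \<and> odd (k div d). real d)
      + (\<Sum>d | d dvd k \<and> even (k div d). real d)"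
    by (rule sum.union_disjoint) (auto intro: finite_subset[OF _ fin])
  finally show ?thesis by (simp add: gbar_def half)
qed

lemma gbar_0 [simp]: "gbar 0 = 0"
  by (simp add: gbar_def divisor_sum_def)

text \<open>The divisor \<open>k\<close> itself has the odd cofactor 1.\<close>

lemma gbar_ge: "real k \<le> gbar k"
proof (cases "k = 0")
  case False
  have "real k = (\<Sum>d\<in>{k}. real d)" by simp
  also have "\<dots> \<le> gbar k"
    unfolding gbar_eq[OF False[THEN neq0_conv[THEN iffD1]]]
    using False by (intro sum_mono2) auto
  finally show ?thesis .
qed simp

text \<open>Write \<open>k = d * e\<close> with odd cofactor \<open>e\<close> and sum over
  \<open>d\<close> first: for fixed \<open>e\<close>, the condition \<open>k \<le> n\<close> means
  \<open>d \<le> n div e\<close>.\<close>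

lemma sum_gbar: "(\<Sum>k=1..n. gbar k) = (\<Sum>e | e \<in> {1..n} \<and> odd e. \<Sum>d=1..n div e. real d)"
proof -
  have "(\<Sum>k=1..n. gbar k) = (\<Sum>k=1..n. \<Sum>d | d dvd k \<and> odd (k div d). real d)"
    by (intro sum.cong gbar_eq) auto
  also have "\<dots> = (\<Sum>(k, d)\<in>(SIGMA k:{1..n}. {d. d dvd k \<and> odd (k div d)}). real d)"
    by (rule sum.Sigma) auto
  also have "\<dots> = (\<Sum>(e, d)\<in>(SIGMA e:{e. e \<in> {1..n} \<and> odd e}. {1..n div e}). real d)"
  proof (rule sum.reindex_bij_witness[of _ "\<lambda>(e, d). (d * e, d)" "\<lambda>(k, d). (k div d, d)"])
    fix x assume "x \<in> (SIGMA k:{1..n}. {d. d dvd k \<and> odd (k div d)})"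
    then obtain k d where x: "x = (k, d)" and k: "1 \<le> k" "k \<le> n" "d dvd k" "odd (k div d)"
      by auto
    then have "d > 0" by (auto intro: Nat.gr0I)
    with k(1,3) have pos: "k div d > 0" by (simp add: div_greater_zero_iff dvd_imp_le)
    have "d * (k div d) \<le> n" using k by simp
    with pos have "d \<le> n div (k div d)" by (simp add: less_eq_div_iff_mult_less_eq)
    moreover have "k div d \<le> n" using k(2) div_le_dividend le_trans by blast
    ultimately show "(case x of (k, d) \<Rightarrow> (k div d, d)) \<in> (SIGMA e:{e. e \<in> {1..n} \<and> odd e}. {1..n div e})"
      using \<open>d > 0\<close> pos k(4) by (simp add: x Suc_le_eq)
    show "(case case x of (k, d) \<Rightarrow> (k div d, d) of (e, d) \<Rightarrow> (d * e, d)) = x"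
      using k by (simp add: x)
  next
    fix x assume "x \<in> (SIGMA e:{e. e \<in> {1..n} \<and> odd e}. {1..n div e})"
    then obtain e d where x: "x = (e, d)" and e: "1 \<le> e" "e \<le> n" "odd e" "1 \<le> d" "d \<le> n div e"
      by auto
    then have "d * e \<le> n" by (simp add: less_eq_div_iff_mult_less_eq)
    with e show "(case x of (e, d) \<Rightarrow> (d * e, d)) \<in> (SIGMA k:{1..n}. {d. d dvd k \<and> odd (k div d)})"
      by (simp add: x Suc_le_eq)
    show "(case case x of (e, d) \<Rightarrow> (d * e, d) of (k, d) \<Rightarrow> (k div d, d)) = x"
      using e by (simp add: x)
  qed auto
  also have "\<dots> = (\<Sum>e | e \<in> {1..n} \<and> odd e. \<Sum>d=1..n div e. real d)"
    by (rule sum.Sigma[symmetric]) auto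
  finally show ?thesis .
qed

text \<open>The supremum of \<open>m (m + 1) / (n (n + 1))\<close> with \<open>m = n div e\<close> is attained at \<open>n = e\<close>.\<close>

lemma div_triangle_le:
  assumes "e > 0"
  shows "real (n div e) * (real (n div e) + 1) \<le> 2 / (real e * (real e + 1)) * (real n * (real n + 1))"
proof (cases "n div e = 0")
  case False
  define m where "m = n div e"
  have "m \<ge> 1" "e \<ge> 1" using False assms by (auto simp: m_def)
  \<comment> \<open>Equality holds for \<open>m = 1\<close>, the case that gives the
    supremum.\<close>
  then have "0 \<le> (real e - 1) * (real m - 1)" by simp
  then have *: "(real e + 1) * (real m + 1) \<le> 2 * (real e * real m + 1)" by (simp add: algebra_simps)
  have "real (e * m) \<le> real n" unfolding of_nat_le_iff by (simp add: m_def)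
  then have le: "real e * real m \<le> real n" by simp
  have "(real m * (real m + 1)) * (real e * (real e + 1))
      = (real e * real m) * ((real e + 1) * (real m + 1))" by (simp add: algebra_simps)
  also have "\<dots> \<le> (real e * real m) * (2 * (real e * real m + 1))"
    using * by (intro mult_left_mono) auto
  also have "\<dots> \<le> real n * (2 * (real n + 1))"
    using le by (intro mult_mono) auto
  finally show ?thesis
    using assms unfolding m_def[symmetric] times_divide_eq_left
    by (subst pos_le_divide_eq) (auto simp: algebra_simps add_pos_pos)
qed (use assms in simp)

text \<open>The full series has sum 2 ln 2 = 1.386..., just below 7/5. The correction
  \<open>1 / (2 * J)\<close> dominates the tail by telescoping, which makes the induction work; at
  \<open>J = 3\<close> the bound is an equality.\<close>

lemma sum_odd_reciprocals_le:
  assumes "J \<ge> 3"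
  shows "(\<Sum>j<J. 2 / ((2 * real j + 1) * (2 * real j + 2))) \<le> 7 / 5 - 1 / (2 * real J)"
  using assms
proof (induction J rule: dec_induct)
  case base
  then show ?case by (simp add: eval_nat_numeral)
next
  case (step J)
  have "2 / ((2 * real J + 1) * (2 * real J + 2)) \<le> 1 / (2 * real J) - 1 / (2 * real (Suc J))"
    using step.hyps by (simp add: divide_simps) (simp add: algebra_simps)
  with step.IH show ?case by simp
qed

lemma sum_gbar_le: "(\<Sum>k=1..n. 2 * gbar k) \<le> 7 / 5 * (real n * (real n + 1))"
proof -
  define t where "t e = 2 / (real e * (real e + 1))" for e :: nat
  have gauss: "(\<Sum>d=1..m. real d) = real m * (real m + 1) / 2" for m
    by (induction m) (auto simp: field_simps)
  have "(\<Sum>k=1..n. 2 * gbar k) = 2 * (\<Sum>e | e \<in> {1..n} \<and> odd e. \<Sum>d=1..n div e. real d)"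
    unfolding sum_gbar[symmetric] by (simp add: sum_distrib_left)
  also have "\<dots> = (\<Sum>e | e \<in> {1..n} \<and> odd e. real (n div e) * (real (n div e) + 1))"
    unfolding gauss by (simp add: sum_distrib_left)
  also have "\<dots> \<le> (\<Sum>e | e \<in> {1..n} \<and> odd e. t e * (real n * (real n + 1)))"
    unfolding t_def by (intro sum_mono div_triangle_le) auto
  also have "\<dots> = (\<Sum>e | e \<in> {1..n} \<and> odd e. t e) * (real n * (real n + 1))"
    by (simp add: sum_distrib_right)
  also have "\<dots> \<le> 7 / 5 * (real n * (real n + 1))"
  proof (rule mult_right_mono)
    \<comment> \<open>The range \<open>n + 3\<close> covers every odd \<open>e \<le> n\<close> and
      meets the requirement of at least three terms.\<close>
    have "(\<Sum>e | e \<in> {1..n} \<and> odd e. t e) \<le> (\<Sum>e\<in>(\<lambda>j. 2 * j + 1) ` {..<n + 3}. t e)"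
      by (intro sum_mono2) (auto simp: t_def elim!: oddE)
    also have "\<dots> = (\<Sum>j<n + 3. 2 / ((2 * real j + 1) * (2 * real j + 2)))"
      by (subst sum.reindex) (auto simp: inj_on_def t_def algebra_simps intro!: sum.cong)
    also have "\<dots> \<le> 7 / 5 - 1 / (2 * real (n + 3))"
      by (rule sum_odd_reciprocals_le) simp
    also have "\<dots> \<le> 7 / 5" by simp
    finally show "(\<Sum>e | e \<in> {1..n} \<and> odd e. t e) \<le> 7 / 5" .
  qed simp
  finally show ?thesis .
qed

section \<open>Generating function of overpartitions\<close>

definition bounded_ops :: "nat \<Rightarrow> nat \<Rightarrow> (nat \<times> bool) list set" where
  "bounded_ops N n = {ps. overpartition n ps \<and> (\<forall>p\<in>set ps. fst p \<le> N)}"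

lemma overpartition_Nil [simp]: "overpartition n [] \<longleftrightarrow> n = 0"
  by (auto simp: overpartition_def)

lemma overpartition_Cons:
  "overpartition n ((a, b) # ps) \<longleftrightarrow>
     a > 0 \<and> a \<le> n \<and> overpartition (n - a) ps \<and> (\<forall>p\<in>set ps. fst p \<le> a) \<and>
     (b \<longrightarrow> (\<forall>p\<in>set ps. fst p \<noteq> a))"
proof -
  let ?ok = "\<lambda>qs. \<forall>i < length qs. snd (qs ! i) \<longrightarrow>
    (\<forall>j. i < j \<and> j < length qs \<longrightarrow> fst (qs ! j) \<noteq> fst (qs ! i))"
  have "?ok ((a, b) # ps) \<longleftrightarrow> (b \<longrightarrow> (\<forall>p\<in>set ps. fst p \<noteq> a)) \<and> ?ok ps"
    unfolding all_set_conv_all_nth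
    by (auto simp: All_less_Suc2 nth_Cons split: nat.splits)
  then show ?thesis
    unfolding overpartition_def by auto
qed

lemma bounded_ops_0: "bounded_ops 0 n = (if n = 0 then {[]} else {})"
proof -
  have "ps \<in> bounded_ops 0 n \<longleftrightarrow> ps = [] \<and> n = 0" for ps
    by (cases ps) (auto simp: bounded_ops_def overpartition_Cons)
  then show ?thesis by (auto simp: set_eq_iff)
qed

text \<open>Either no part equals \<open>Suc N\<close>, or the first part does. If that part is
  plain, further copies may follow; if it is overlined, it is the last occurrence, so the remaining
  parts are at most \<open>N\<close>.\<close>

lemma bounded_ops_Suc:
  "bounded_ops (Suc N) n = bounded_ops N n \<union>
     (if Suc N \<le> n then Cons (Suc N, False) ` bounded_ops (Suc N) (n - Suc N) \<union>
       Cons (Suc N, True) ` bounded_ops N (n - Suc N) else {})" (is "?L = ?R")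
proof (rule set_eqI)
  fix ps
  show "ps \<in> ?L \<longleftrightarrow> ps \<in> ?R"
  proof (cases ps)
    case Nil
    then show ?thesis by (auto simp: bounded_ops_def)
  next
    case (Cons q qs)
    obtain a b where q: "q = (a, b)" by force
    show ?thesis
      unfolding Cons q
      by (cases b; cases "a = Suc N")
        (auto simp: bounded_ops_def overpartition_Cons image_iff le_Suc_eq)
  qed
qed

lemma finite_bounded_ops: "finite (bounded_ops N n)"
proof (induction N arbitrary: n)
  case 0
  then show ?case by (simp add: bounded_ops_0)
next
  case (Suc N)
  show ?case
  \<comment> \<open>The recursion refers to the same bound \<open>Suc N\<close> at a smaller total,
    hence the inner induction on \<open>n\<close>.\<close>
  proof (induction n rule: less_induct)
    case (less n)
    then show ?case by (subst bounded_ops_Suc) (auto simp: Suc)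
  qed
qed

lemma card_bounded_ops_Suc:
  "card (bounded_ops (Suc N) n) = card (bounded_ops N n) +
     (if Suc N \<le> n then card (bounded_ops (Suc N) (n - Suc N)) + card (bounded_ops N (n - Suc N)) else 0)"
proof (cases "Suc N \<le> n")
  case True
  let ?A = "Cons (Suc N, False) ` bounded_ops (Suc N) (n - Suc N)"
  let ?B = "Cons (Suc N, True) ` bounded_ops N (n - Suc N)"
  have "card (bounded_ops N n \<union> (?A \<union> ?B)) = card (bounded_ops N n) + card (?A \<union> ?B)"
    by (rule card_Un_disjoint) (auto simp: finite_bounded_ops, auto simp: bounded_ops_def)
  also have "card (?A \<union> ?B) = card ?A + card ?B"
    by (rule card_Un_disjoint) (auto simp: finite_bounded_ops)
  finally show ?thesis
    using True by (subst bounded_ops_Suc) (simp add: card_image)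
qed (subst bounded_ops_Suc, simp)

lemma pbar_eq_card_bounded_ops:
  assumes "n \<le> N"
  shows "pbar n = card (bounded_ops N n)"
proof -
  have "fst p \<le> n" if "overpartition n ps" "p \<in> set ps" for p ps
    using that member_le_sum_list[of "fst p" "map fst ps"] by (auto simp: overpartition_def)
  then have "{ps. overpartition n ps} = bounded_ops N n"
    using assms by (force simp: bounded_ops_def)
  then show ?thesis by (simp add: pbar_def)
qed

definition op_fps :: "nat \<Rightarrow> real fps" where
  "op_fps N = Abs_fps (\<lambda>n. real (card (bounded_ops N n)))"

lemma op_fps_0: "op_fps 0 = 1"
  by (rule fps_ext) (simp add: op_fps_def bounded_ops_0)

text \<open>This is the cardinality recursion with the plain first part moved to the left; the
  overlined one contributes the factor on the right.\<close>

lemma op_fps_Suc: "(1 - fps_X ^ Suc N) * op_fps (Suc N) = (1 + fps_X ^ Suc N) * op_fps N"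
proof (rule fps_ext)
  fix n
  show "((1 - fps_X ^ Suc N) * op_fps (Suc N)) $ n = ((1 + fps_X ^ Suc N) * op_fps N) $ n"
    unfolding ring_distribs left_diff_distrib mult_1_left fps_sub_nth fps_add_nth fps_X_power_mult_nth
    using card_bounded_ops_Suc[of N n] by (simp add: op_fps_def)
qed

lemma op_fps_eq_prod: "op_fps N = (\<Prod>m<N. (1 + fps_X ^ Suc m) / (1 - fps_X ^ Suc m))"
proof (induction N)
  case 0
  then show ?case by (simp add: op_fps_0)
next
  case (Suc N)
  have unit: "(1 - fps_X ^ Suc N :: real fps) $ 0 \<noteq> 0" by simp
  have "op_fps (Suc N) = (1 - fps_X ^ Suc N) * op_fps (Suc N) * inverse (1 - fps_X ^ Suc N)"
    using inverse_mult_eq_1'[OF unit] by (simp add: mult.commute mult.left_commute)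
  also have "\<dots> = op_fps N * ((1 + fps_X ^ Suc N) / (1 - fps_X ^ Suc N))"
    unfolding op_fps_Suc fps_divide_unit[OF unit] by (simp only: mult_ac)
  finally show ?case by (simp add: Suc.IH)
qed

text \<open>With X for \<open>fps_X\<close>, this is X times the logarithmic derivative of (1 + X^m)
  / (1 - X^m), that is 2 m X^m / (1 - X^(2m)) for positive \<open>m\<close>.\<close>

definition log_deriv_term :: "nat \<Rightarrow> real fps" where
  "log_deriv_term m = Abs_fps (\<lambda>k. if m dvd k \<and> odd (k div m) then 2 * real m else 0)"

text \<open>The coefficients have period \<open>2 * m\<close>, so multiplying by
  \<open>1 - fps_X ^ (2 * m)\<close> cancels all of them except the one at index
  \<open>m\<close>.\<close>

lemma log_deriv_term_mult:
  assumes "m > 0"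
  shows "(1 - fps_X ^ m) * (1 + fps_X ^ m) * log_deriv_term m = fps_const (2 * real m) * fps_X ^ m"
proof -
  define Y :: "real fps" where "Y = fps_X ^ m"
  have "(1 - Y) * (1 + Y) * log_deriv_term m = log_deriv_term m - (Y * Y) * log_deriv_term m"
    by (simp add: algebra_simps)
  also have "Y * Y = fps_X ^ (2 * m)" by (simp only: Y_def mult_2 power_add)
  finally have "(1 - fps_X ^ m) * (1 + fps_X ^ m) * log_deriv_term m
      = log_deriv_term m - fps_X ^ (2 * m) * log_deriv_term m" by (simp only: Y_def)
  also have "\<dots> = fps_const (2 * real m) * fps_X ^ m"
  proof (rule fps_ext)
    fix k
    show "(log_deriv_term m - fps_X ^ (2 * m) * log_deriv_term m) $ k
        = (fps_const (2 * real m) * fps_X ^ m) $ k"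
    proof (cases "k < 2 * m")
      case True
      have "m dvd k \<and> odd (k div m) \<longleftrightarrow> k = m"
      proof
        assume "m dvd k \<and> odd (k div m)"
        moreover then obtain c where "k = m * c" by (auto elim: dvdE)
        ultimately show "k = m" using True assms by (cases c) auto
      qed (use assms in auto)
      with True show ?thesis by (simp add: log_deriv_term_def fps_X_power_mult_nth)
    next
      case False
      then obtain j where j: "k = j + 2 * m" by (metis add.commute le_iff_add not_less)
      show ?thesis
        using assms by (auto simp: log_deriv_term_def fps_X_power_mult_nth j)
    qed
  qed
  finally show ?thesis .
qed

lemma fps_X_deriv_power: "fps_X * fps_deriv (fps_X ^ m) = fps_const (real m) * fps_X ^ m"
proof (cases m)
  case (Suc k)
  show ?thesis
    unfolding Suc fps_deriv_power fps_deriv_fps_X diff_Suc_1 mult_1_right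
    by (simp only: power_Suc mult.left_commute)
qed simp

text \<open>Logarithmic derivatives turn products into sums; the induction differentiates
  \<open>op_fps_Suc\<close> and clears the denominators.\<close>

lemma op_fps_log_deriv:
  "fps_X * fps_deriv (op_fps N) = (\<Sum>m=1..N. log_deriv_term m) * op_fps N"
proof (induction N)
  case 0
  then show ?case by (simp add: op_fps_0)
next
  case (Suc N)
  define Y :: "real fps" where "Y = fps_X ^ Suc N"
  define F where "F = op_fps (Suc N)"
  define E where "E = op_fps N"
  define L where "L = (\<Sum>m=1..N. log_deriv_term m)"
  define l where "l = log_deriv_term (Suc N)"
  define c where "c = fps_const (real (Suc N))"
  have rec: "(1 - Y) * F = (1 + Y) * E" using op_fps_Suc by (simp add: Y_def F_def E_def)
  have XY: "fps_X * fps_deriv Y = c * Y"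
    unfolding Y_def c_def by (rule fps_X_deriv_power)
  have l: "(1 - Y) * (1 + Y) * l = 2 * c * Y"
    using log_deriv_term_mult[of "Suc N"]
    by (simp add: Y_def l_def c_def fps_const_mult[symmetric] numeral_fps_const del: fps_const_mult)
  have "fps_deriv ((1 - Y) * F) = fps_deriv ((1 + Y) * E)" by (simp only: rec)
  then have "(1 - Y) * fps_deriv F - fps_deriv Y * F = (1 + Y) * fps_deriv E + fps_deriv Y * E"
    by (simp add: algebra_simps)
  then have "fps_X * ((1 - Y) * fps_deriv F - fps_deriv Y * F)
      = fps_X * ((1 + Y) * fps_deriv E + fps_deriv Y * E)" by simp
  then have "(1 - Y) * (fps_X * fps_deriv F) - fps_X * fps_deriv Y * F
      = (1 + Y) * (fps_X * fps_deriv E) + fps_X * fps_deriv Y * E"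
    by (simp only: ring_distribs right_diff_distrib left_diff_distrib mult_1_left mult_ac)
  then have "(1 - Y) * (fps_X * fps_deriv F) - c * Y * F
      = (1 + Y) * (fps_X * fps_deriv E) + c * Y * E"
    by (simp only: XY)
  also have "fps_X * fps_deriv E = L * E" using Suc.IH by (simp add: E_def L_def)
  finally have eq: "(1 - Y) * (fps_X * fps_deriv F) - c * Y * F = (1 + Y) * (L * E) + c * Y * E" .
  \<comment> \<open>The extra factor \<open>1 + Y\<close> makes \<open>E\<close> occur only as
    \<open>(1 + Y) * E\<close>, which \<open>rec\<close> replaces by
    \<open>(1 - Y) * F\<close>.\<close>
  have "(1 - Y) * (1 + Y) * (fps_X * fps_deriv F)
      = (1 + Y) * ((1 - Y) * (fps_X * fps_deriv F) - c * Y * F) + (1 + Y) * c * Y * F"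
    by (simp add: algebra_simps)
  also have "\<dots> = (1 + Y) * L * ((1 + Y) * E) + c * Y * ((1 + Y) * E) + (1 + Y) * c * Y * F"
    unfolding eq by (simp add: algebra_simps)
  also have "\<dots> = (1 - Y) * (1 + Y) * (L * F) + (2 * c * Y) * F"
    unfolding rec[symmetric] by (simp add: algebra_simps)
  also have "\<dots> = (1 - Y) * (1 + Y) * ((L + l) * F)"
    unfolding l[symmetric] by (simp add: algebra_simps)
  finally have "(1 - Y) * (1 + Y) * (fps_X * fps_deriv F) = (1 - Y) * (1 + Y) * ((L + l) * F)" .
  moreover have "(1 - Y) * (1 + Y) \<noteq> 0"
  proof -
    have "((1 - Y) * (1 + Y)) $ 0 = 1" by (simp add: Y_def)
    then show ?thesis by force
  qed
  ultimately have "fps_X * fps_deriv F = (L + l) * F" by simp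
  then show ?case by (simp add: F_def L_def l_def)
qed

text \<open>Only divisors \<open>m\<close> of \<open>k\<close> contribute, and for positive
  \<open>k\<close> these lie below the truncation bound \<open>N\<close>.\<close>

lemma sum_log_deriv_term_nth:
  assumes "k \<le> N"
  shows "(\<Sum>m=1..N. log_deriv_term m) $ k = 2 * gbar k"
proof (cases "k = 0")
  case False
  have "(\<Sum>m=1..N. log_deriv_term m) $ k
      = (\<Sum>m=1..N. if m dvd k \<and> odd (k div m) then 2 * real m else 0)"
    by (simp add: fps_sum_nth log_deriv_term_def)
  also have "\<dots> = (\<Sum>m | m dvd k \<and> odd (k div m). 2 * real m)"
  proof (rule sum.mono_neutral_cong_right)
    show "{m. m dvd k \<and> odd (k div m)} \<subseteq> {1..N}"
    proof
      fix m assume "m \<in> {m. m dvd k \<and> odd (k div m)}"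
      then have "m dvd k" by simp
      with False have "m \<le> k" "m > 0" by (auto intro: dvd_imp_le Nat.gr0I)
      with assms show "m \<in> {1..N}" by simp
    qed
  qed auto
  finally show ?thesis using False by (simp add: gbar_eq sum_distrib_left)
qed (simp add: fps_sum_nth log_deriv_term_def)

section \<open>Identification of the overpartition numbers with the polynomial values at 2\<close>

definition p2 :: "nat \<Rightarrow> real" where
  "p2 n = poly (P_poly n) 2"

lemma p2_0 [simp]: "p2 0 = 1"
  by (simp add: p2_def)

lemma p2_rec: "real n * p2 n = (\<Sum>k=1..n. 2 * gbar k * p2 (n - k))"
proof (cases n)
  case (Suc m)
  show ?thesis
    unfolding Suc p2_def P_poly.simps
    by (simp add: poly_sum sum_distrib_left mult.assoc del: sum.cl_ivl_Suc)
qed simp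

text \<open>Up to index \<open>N\<close> both sequences start with 1 and satisfy the recurrence
  \<open>p2_rec\<close>, which for \<open>op_fps\<close> is the coefficient form of
  \<open>op_fps_log_deriv\<close>.\<close>

lemma op_fps_nth: "n \<le> N \<Longrightarrow> op_fps N $ n = p2 n"
proof (induction n rule: less_induct)
  case (less n)
  show ?case
  proof (cases "n = 0")
    case True
    have "card (bounded_ops N 0) = 1"
      by (induction N) (simp_all add: bounded_ops_0 card_bounded_ops_Suc)
    with True show ?thesis by (simp add: op_fps_def)
  next
    case False
    have "real n * op_fps N $ n = (fps_X * fps_deriv (op_fps N)) $ n"
      using False by (simp add: fps_X_mult_nth)
    also have "\<dots> = (\<Sum>k=0..n. (\<Sum>m=1..N. log_deriv_term m) $ k * op_fps N $ (n - k))"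
      unfolding op_fps_log_deriv by (simp add: fps_mult_nth)
    also have "\<dots> = (\<Sum>k=0..n. 2 * gbar k * op_fps N $ (n - k))"
      using less.prems by (intro sum.cong refl arg_cong2[where f = "(*)"] sum_log_deriv_term_nth) simp
    also have "\<dots> = (\<Sum>k=1..n. 2 * gbar k * p2 (n - k))"
      using less by (simp add: sum.atLeast_Suc_atMost)
    also have "\<dots> = real n * p2 n" by (rule p2_rec[symmetric])
    finally show ?thesis using False by simp
  qed
qed

lemma pbar_eq_p2: "real (pbar n) = p2 n"
  using op_fps_nth[of n n] pbar_eq_card_bounded_ops[of n n] by (simp add: op_fps_def)

lemma has_prod_pbar:
  "(\<lambda>m. (1 + fps_X ^ Suc m) / (1 - fps_X ^ Suc m)) has_prod (Abs_fps (\<lambda>n. real (pbar n)))"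
proof -
  have "(\<lambda>N. \<Prod>i\<le>N. (1 + fps_X ^ Suc i) / (1 - fps_X ^ Suc i)) \<longlonglongrightarrow> Abs_fps (\<lambda>n. real (pbar n))"
    unfolding tendsto_fps_iff
  proof
    fix n
    \<comment> \<open>Convergence of formal power series is coefficientwise, and each coefficient of
      the partial products is eventually constant.\<close>
    have "(\<Prod>i\<le>N. (1 + fps_X ^ Suc i) / (1 - fps_X ^ Suc i)) $ n = Abs_fps (\<lambda>n. real (pbar n)) $ n"
      if "N \<ge> n" for N
      using that op_fps_nth[of n "Suc N"]
      by (simp only: lessThan_Suc_atMost[symmetric] op_fps_eq_prod[symmetric] pbar_eq_p2
        fps_nth_Abs_fps le_SucI)
    then show "\<forall>\<^sub>F N in sequentially.
        (\<Prod>i\<le>N. (1 + fps_X ^ Suc i) / (1 - fps_X ^ Suc i)) $ n = Abs_fps (\<lambda>n. real (pbar n)) $ n"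
      by (auto simp: eventually_sequentially)
  qed
  \<comment> \<open>\<open>has_prod\<close> also demands a nonzero limit.\<close>
  moreover have "Abs_fps (\<lambda>n. real (pbar n)) $ 0 \<noteq> 0" by (simp add: pbar_eq_p2)
  then have "Abs_fps (\<lambda>n. real (pbar n)) \<noteq> 0" by (metis fps_zero_nth)
  ultimately show ?thesis by (auto simp: has_prod_def raw_has_prod_def)
qed

section \<open>Increments of \<open>P\<^sub>n(2)\<close>\<close>

lemma p2_pos: "p2 n > 0"
proof (induction n rule: less_induct)
  case (less n)
  show ?case
  proof (cases "n = 0")
    case False
    have "0 < (\<Sum>k=1..n. 2 * gbar k * p2 (n - k))"
    proof (rule sum_pos)
      fix k assume "k \<in> {1..n}"
      then have "gbar k > 0" "p2 (n - k) > 0" using gbar_ge[of k] less by auto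
      then show "0 < 2 * gbar k * p2 (n - k)" by simp
    qed (use False in auto)
    then have "0 < real n * p2 n" by (simp only: p2_rec)
    with False show ?thesis by (simp add: zero_less_mult_iff)
  qed simp
qed

section \<open>Nonnegative second differences\<close>

definition p2_fps :: "real fps" where "p2_fps = Abs_fps p2"
definition gbar_fps :: "real fps" where "gbar_fps = Abs_fps (\<lambda>k. 2 * gbar k)"
definition second_diff :: "real fps" where "second_diff = (1 - fps_X) * ((1 - fps_X) * p2_fps)"

lemma p2_fps_deriv: "fps_X * fps_deriv p2_fps = gbar_fps * p2_fps"
proof (rule fps_ext)
  fix n
  have "(fps_X * fps_deriv p2_fps) $ n = real n * p2 n"
    by (cases n) (simp_all add: p2_fps_def)
  then show "(fps_X * fps_deriv p2_fps) $ n = (gbar_fps * p2_fps) $ n"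
    by (simp add: p2_rec fps_mult_nth p2_fps_def gbar_fps_def sum.atLeast_Suc_atMost)
qed

lemma one_minus_fps_X_mult_nth:
  "((1 - fps_X) * f) $ n = f $ n - (if n = 0 then 0 else f $ (n - 1))" for f :: "real fps"
  by (simp add: left_diff_distrib)

text \<open>Multiplying by \<open>(1 - fps_X)\<^sup>2\<close> subtracts 2 X / (1 - X) from X times
  the logarithmic derivative, that is, 2 from every coefficient of positive index.\<close>

lemma second_diff_deriv:
  "fps_X * fps_deriv second_diff = Abs_fps (\<lambda>k. if k = 0 then 0 else 2 * gbar k - 2) * second_diff"
proof -
  define R :: "real fps" where "R = Abs_fps (\<lambda>k. if k = 0 then 0 else 1)"
  have R: "(1 - fps_X) * R = fps_X"
    by (rule fps_ext) (auto simp: one_minus_fps_X_mult_nth R_def)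
  have "fps_X * fps_deriv second_diff
      = (1 - fps_X) * ((1 - fps_X) * (fps_X * fps_deriv p2_fps)) - 2 * fps_X * ((1 - fps_X) * p2_fps)"
    by (simp add: second_diff_def algebra_simps)
  also have "2 * fps_X * ((1 - fps_X) * p2_fps) = 2 * R * second_diff"
    unfolding second_diff_def by (subst R[symmetric]) (simp only: mult_ac)
  also have "(1 - fps_X) * ((1 - fps_X) * (fps_X * fps_deriv p2_fps)) = gbar_fps * second_diff"
    unfolding second_diff_def p2_fps_deriv by (simp only: mult_ac)
  also have "gbar_fps * second_diff - 2 * R * second_diff = (gbar_fps - 2 * R) * second_diff"
    by (simp add: algebra_simps)
  also have "gbar_fps - 2 * R = Abs_fps (\<lambda>k. if k = 0 then 0 else 2 * gbar k - 2)"
    by (rule fps_ext) (simp add: gbar_fps_def R_def numeral_fps_const)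
  finally show ?thesis .
qed

text \<open>The recurrence from \<open>second_diff_deriv\<close> has coefficients
  \<open>2 * gbar k - 2\<close>, nonnegative because \<open>gbar k \<ge> k \<ge> 1\<close>, and it
  starts with 1.\<close>

lemma second_diff_nonneg: "second_diff $ n \<ge> 0"
proof (induction n rule: less_induct)
  case (less n)
  define c where "c k = (if k = 0 then 0 else 2 * gbar k - 2)" for k
  show ?case
  proof (cases "n = 0")
    case True
    then show ?thesis by (simp add: second_diff_def p2_fps_def)
  next
    case False
    have "real n * second_diff $ n = (fps_X * fps_deriv second_diff) $ n"
      using False by simp
    also have "\<dots> = (\<Sum>k=0..n. c k * second_diff $ (n - k))"
      unfolding second_diff_deriv c_def by (simp add: fps_mult_nth)
    also have "\<dots> \<ge> 0"
    proof (rule sum_nonneg)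
      fix k assume "k \<in> {0..n}"
      show "0 \<le> c k * second_diff $ (n - k)"
      proof (cases "k = 0")
        case False
        then have "c k \<ge> 0" using gbar_ge[of k] by (simp add: c_def)
        moreover have "second_diff $ (n - k) \<ge> 0" using False \<open>k \<in> {0..n}\<close> by (intro less) auto
        ultimately show ?thesis by simp
      qed (simp add: c_def)
    qed
    finally show ?thesis using False by (simp add: zero_le_mult_iff)
  qed
qed

section \<open>Increments of \<open>n * p2 n\<close> against partial sums\<close>

definition p2_sum :: "nat \<Rightarrow> real" where
  "p2_sum n = (\<Sum>j\<le>n. p2 j)"

lemma p2_sum_Suc: "p2_sum (Suc n) = p2_sum n + p2 (Suc n)"
  by (simp add: p2_sum_def)

lemma p2_sum_pos: "p2_sum n > 0"
  unfolding p2_sum_def by (rule sum_pos) (auto simp: p2_pos)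

text \<open>Multiplying \<open>t P' = 2 G P\<close> by \<open>1 - t\<close> turns \<open>2 G P\<close> into \<open>(2 G / (1 - t)) ((1 - t)\<^sup>2 P)\<close>, whose
  second factor is nonnegative, so that bounds for the partial sums of \<open>2 G\<close> suffice.\<close>

lemma p2_increment:
  shows "2 * p2_sum n \<le> real (n + 1) * p2 (n + 1) - real n * p2 n" (is ?lower)
    and "real (n + 1) * p2 (n + 1) - real n * p2 n \<le> 14 / 5 * p2_sum n" (is ?upper)
proof -
  define H :: "real fps" where "H = Abs_fps (\<lambda>n. \<Sum>k=1..n. 2 * gbar k)"
  \<comment> \<open>\<open>K\<close> is the comparison series for \<open>H\<close>. Three factors
    \<open>1 - fps_X\<close> reduce it to \<open>2 * fps_X\<close>, so its product with
    \<open>second_diff\<close> is a shifted series of partial sums.\<close>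
  define K :: "real fps" where "K = Abs_fps (\<lambda>n. real n * (real n + 1))"
  define T :: "real fps" where "T = Abs_fps (\<lambda>n. 2 * real n)"
  define R :: "real fps" where "R = Abs_fps (\<lambda>n. if n = 0 then 0 else 2)"
  define S :: "real fps" where "S = Abs_fps p2_sum"
  have H: "(1 - fps_X) * H = gbar_fps"
  proof (rule fps_ext)
    show "((1 - fps_X) * H) $ n = gbar_fps $ n" for n
      by (cases n) (simp_all add: one_minus_fps_X_mult_nth H_def gbar_fps_def)
  qed
  have K: "(1 - fps_X) * K = T"
  proof (rule fps_ext)
    show "((1 - fps_X) * K) $ n = T $ n" for n
      by (cases n) (simp_all add: one_minus_fps_X_mult_nth K_def T_def algebra_simps)
  qed
  have T: "(1 - fps_X) * T = R"
  proof (rule fps_ext)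
    show "((1 - fps_X) * T) $ n = R $ n" for n
      by (cases n) (simp_all add: one_minus_fps_X_mult_nth T_def R_def)
  qed
  have R: "(1 - fps_X) * R = 2 * fps_X"
    by (rule fps_ext) (auto simp: one_minus_fps_X_mult_nth R_def numeral_fps_const)
  have S: "(1 - fps_X) * S = p2_fps"
  proof (rule fps_ext)
    show "((1 - fps_X) * S) $ n = p2_fps $ n" for n
      by (cases n) (simp_all add: one_minus_fps_X_mult_nth S_def p2_fps_def p2_sum_def)
  qed
  have "(1 - fps_X) * (fps_X * fps_deriv p2_fps) = H * second_diff"
    unfolding p2_fps_deriv second_diff_def H[symmetric] by (simp only: mult_ac)
  then have "(H * second_diff) $ (n + 1) = ((1 - fps_X) * (fps_X * fps_deriv p2_fps)) $ (n + 1)"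
    by simp
  also have "\<dots> = real (n + 1) * p2 (n + 1) - real n * p2 n"
    by (cases n) (simp_all add: one_minus_fps_X_mult_nth p2_fps_def)
  finally have Hn: "real (n + 1) * p2 (n + 1) - real n * p2 n = (H * second_diff) $ (n + 1)" by simp
  have "K * second_diff = ((1 - fps_X) * ((1 - fps_X) * ((1 - fps_X) * K))) * S"
    unfolding second_diff_def S[symmetric] by (simp only: mult_ac)
  also have "\<dots> = 2 * (fps_X * S)" by (simp only: K T R mult.assoc)
  finally have "K * second_diff = 2 * (fps_X * S)" .
  then have Kn: "(K * second_diff) $ (n + 1) = 2 * p2_sum n"
    by (simp add: numeral_fps_const S_def)
  have "real j * (real j + 1) \<le> (\<Sum>k=1..j. 2 * gbar k)" for j
  proof -
    have "real j * (real j + 1) = (\<Sum>k=1..j. 2 * real k)"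
      by (induction j) (auto simp: algebra_simps)
    also have "\<dots> \<le> (\<Sum>k=1..j. 2 * gbar k)" by (intro sum_mono) (simp add: gbar_ge)
    finally show ?thesis .
  qed
  then have "(K * second_diff) $ (n + 1) \<le> (H * second_diff) $ (n + 1)"
    unfolding fps_mult_nth K_def H_def
    by (intro sum_mono mult_right_mono second_diff_nonneg) simp
  with Hn Kn show ?lower by simp
  \<comment> \<open>The factor 7/5 from \<open>sum_gbar_le\<close> and the 2 in \<open>Kn\<close>
    give the constant 14/5.\<close>
  have "(H * second_diff) $ (n + 1) \<le> (\<Sum>i=0..n + 1. 7 / 5 * K $ i * second_diff $ (n + 1 - i))"
    unfolding fps_mult_nth K_def H_def fps_nth_Abs_fps
    by (intro sum_mono mult_right_mono second_diff_nonneg sum_gbar_le)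
  also have "\<dots> = 7 / 5 * (K * second_diff) $ (n + 1)"
    unfolding fps_mult_nth sum_distrib_left by (simp only: mult.assoc)
  finally show ?upper using Hn Kn by simp
qed

section \<open>Exact values up to index 36\<close>

text \<open>\<open>gs\<close> holds \<open>gbar 1, gbar 2, \<dots>\<close>, whereas \<open>ps\<close> runs downwards and ends in \<open>p2 0\<close>.\<close>

fun recurrence_table :: "int list \<Rightarrow> int list \<Rightarrow> bool" where
  "recurrence_table gs [] \<longleftrightarrow> True"
| "recurrence_table gs (p # ps) \<longleftrightarrow> recurrence_table gs ps \<and>
     (if ps = [] then p = 1 else int (length ps) * p = 2 * sum_list (map2 (*) gs ps))"

text \<open>Because \<open>ps\<close> is reversed, its tail is the table for smaller indices, and
  \<open>map2\<close> pairs \<open>gbar k\<close> with \<open>p2 (n - k)\<close>; the convolution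
  becomes a scalar product that evaluates without index arithmetic.\<close>

lemma recurrence_table_imp_p2:
  assumes gs: "\<And>k. k < length gs \<Longrightarrow> gbar (Suc k) = real_of_int (gs ! k)"
    and "recurrence_table gs ps" and "length ps \<le> Suc (length gs)" and "i < length ps"
  shows "p2 (length ps - Suc i) = real_of_int (ps ! i)"
  using assms(2-)
proof (induction ps arbitrary: i)
  case (Cons p ps)
  define n where "n = length ps"
  have IH: "p2 (n - Suc j) = real_of_int (ps ! j)" if "j < n" for j
    using Cons that by (simp add: n_def)
  have "p2 n = real_of_int p"
  proof (cases "ps = []")
    case False
    have n: "n > 0" "n \<le> length gs" using False Cons.prems by (simp_all add: n_def)
    have "real n * p2 n = (\<Sum>k=1..n. 2 * gbar k * p2 (n - k))" by (rule p2_rec)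
    also have "\<dots> = (\<Sum>k<n. 2 * gbar (Suc k) * p2 (n - Suc k))"
      by (rule sum.reindex_bij_witness[of _ Suc "\<lambda>k. k - 1"]) auto
    also have "\<dots> = (\<Sum>k<n. 2 * real_of_int (gs ! k) * real_of_int (ps ! k))"
      using n by (intro sum.cong) (simp_all add: gs IH)
    also have "\<dots> = real_of_int (2 * (\<Sum>k<n. gs ! k * ps ! k))"
      by (simp add: sum_distrib_left mult.assoc)
    also have "(\<Sum>k<n. gs ! k * ps ! k) = sum_list (map2 (*) gs ps)"
      using n by (simp add: sum_list_sum_nth n_def atLeast0LessThan)
    also have "2 * \<dots> = int n * p"
      using Cons.prems(1) False by (simp add: n_def)
    finally show ?thesis using n by simp
  qed (use Cons.prems in \<open>simp add: n_def\<close>)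
  then show ?case
    using IH Cons.prems(3) by (cases i) (simp_all add: n_def)
qed simp

text \<open>A filtered list of candidate divisors can be evaluated by rewriting.\<close>

lemma gbar_Suc_eq_sum_list:
  "gbar (Suc k) = real_of_int (sum_list (map int (filter (\<lambda>d. d dvd Suc k \<and> odd (Suc k div d)) [1..<Suc (Suc k)])))"
proof -
  have "{d. d dvd Suc k \<and> odd (Suc k div d)} = set (filter (\<lambda>d. d dvd Suc k \<and> odd (Suc k div d)) [1..<Suc (Suc k)])"
    using dvd_imp_le[of _ "Suc k"]
    by (auto simp: less_Suc_eq_le Suc_le_eq simp del: upt_Suc intro: Nat.gr0I)
  then have "gbar (Suc k) = real_of_int (\<Sum>d\<in>set (filter (\<lambda>d. d dvd Suc k \<and> odd (Suc k div d)) [1..<Suc (Suc k)]). int d)"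
    unfolding gbar_eq[OF zero_less_Suc] by simp
  then show ?thesis
    by (simp only: sum_list_distinct_conv_sum_set distinct_filter distinct_upt)
qed

lemma gbar_table:
  "map (\<lambda>k. gbar (Suc k)) [0..<36] = map real_of_int
    [1, 2, 4, 4, 6, 8, 8, 8, 13, 12, 12, 16, 14, 16, 24, 16, 18, 26, 20, 24, 32, 24, 24, 32,
     31, 28, 40, 32, 30, 48, 32, 32, 48, 36, 48, 52]"
  unfolding gbar_Suc_eq_sum_list
  by (simp add: upt_rec[of 0 "numeral n" for n] upt_rec[of "Suc 0" "numeral n" for n]
    numeral_2_eq_2[symmetric] del: upt_Suc)

lemma p2_table:
  "map p2 [0..<37] = map real_of_int
    [1, 2, 4, 8, 14, 24, 40, 64, 100, 154, 232, 344, 504, 728, 1040, 1472, 2062, 2864, 3948,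
     5400, 7336, 9904, 13288, 17728, 23528, 31066, 40824, 53408, 69568, 90248, 116624, 150144,
     192612, 246256, 313808, 398640, 504886]"
  (is "_ = map _ ?ps")
proof -
  let ?gs = "[1, 2, 4, 4, 6, 8, 8, 8, 13, 12, 12, 16, 14, 16, 24, 16, 18, 26, 20, 24, 32, 24, 24, 32,
     31, 28, 40, 32, 30, 48, 32, 32, 48, 36, 48, 52] :: int list"
  have gs: "gbar (Suc k) = real_of_int (?gs ! k)" if "k < length ?gs" for k
  proof -
    have "k < 36" using that by simp
    then have "gbar (Suc k) = map (\<lambda>k. gbar (Suc k)) [0..<36] ! k" by (simp del: upt_rec_numeral)
    then show ?thesis unfolding gbar_table using that by (simp only: nth_map)
  qed
  have table: "recurrence_table ?gs (rev ?ps)" by simp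
  show ?thesis
  proof (rule nth_equalityI)
    fix j assume "j < length (map p2 [0..<37])"
    then have j: "j < 37" by (simp del: upt_rec_numeral)
    have len: "length (rev ?ps) = 37" by simp
    have "p2 (length (rev ?ps) - Suc (36 - j)) = real_of_int (rev ?ps ! (36 - j))"
      by (rule recurrence_table_imp_p2[OF gs table]) (use j in simp_all)
    also have "rev ?ps ! (36 - j) = ?ps ! j"
      using j len by (subst rev_nth) simp_all
    also have "length (rev ?ps) - Suc (36 - j) = j" using j len by linarith
    finally show "map p2 [0..<37] ! j = map real_of_int ?ps ! j"
      using j len by (simp only: nth_map nth_upt length_upt length_rev) simp
  qed simp
qed

section \<open>Growth of \<open>P\<^sub>n(2)\<close>\<close>

text \<open>Dividing the increment bounds by \<open>p2 n\<close> leaves this quotient as the only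
  unknown.\<close>

definition mean_ratio :: "nat \<Rightarrow> real" where
  "mean_ratio n = p2_sum n / p2 n"

lemma mean_ratio_pos: "mean_ratio n > 0"
  by (simp add: mean_ratio_def p2_pos p2_sum_pos)

lemma p2_ratio_bounds:
  shows "(real n + 2 * mean_ratio n) / (real n + 1) \<le> p2 (Suc n) / p2 n"
    and "p2 (Suc n) / p2 n \<le> (real n + 14 / 5 * mean_ratio n) / (real n + 1)"
proof -
  have eq: "(real n + c * mean_ratio n) * p2 n = real n * p2 n + c * p2_sum n" for c
    using p2_pos[of n] by (simp add: mean_ratio_def algebra_simps)
  have pos: "real n + 1 > 0" by (simp add: add_nonneg_pos)
  show "(real n + 2 * mean_ratio n) / (real n + 1) \<le> p2 (Suc n) / p2 n"
    using p2_increment(1)[of n] eq[of 2]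
    by (simp only: pos_divide_le_eq[OF pos] times_divide_eq_left pos_le_divide_eq[OF p2_pos])
      (simp add: algebra_simps)
  show "p2 (Suc n) / p2 n \<le> (real n + 14 / 5 * mean_ratio n) / (real n + 1)"
    using p2_increment(2)[of n] eq[of "14 / 5"]
    by (simp only: pos_le_divide_eq[OF pos] times_divide_eq_left pos_divide_le_eq[OF p2_pos])
      (simp add: algebra_simps)
qed

lemma mean_ratio_Suc: "mean_ratio (Suc n) = 1 + mean_ratio n / (p2 (Suc n) / p2 n)"
  using p2_pos[of n] p2_pos[of "Suc n"] by (simp add: mean_ratio_def p2_sum_Suc field_simps)

section \<open>Propagation of bounds on \<open>mean_ratio\<close>\<close>

lemma divide_affine_mono:
  fixes x y a c :: real
  assumes "0 < x" "x \<le> y" "0 \<le> a" "0 < c"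
  shows "x / (a + c * x) \<le> y / (a + c * y)"
proof -
  have "a * x \<le> a * y" using assms by (intro mult_left_mono) auto
  moreover have "a + c * x > 0" "a + c * y > 0"
    using assms by (auto intro!: add_nonneg_pos)
  ultimately show ?thesis by (simp add: frac_le_eq divide_le_0_iff) (simp add: algebra_simps)
qed

text \<open>Inserting the ratio bounds into \<open>mean_ratio_Suc\<close> gives maps that increase
  in \<open>mean_ratio n\<close>, so a bound on it may be substituted. The lower ratio bound yields
  the upper estimate and vice versa.\<close>

lemma mean_ratio_Suc_bounds:
  assumes "n > 0"
  shows "mean_ratio n \<le> y \<Longrightarrow> mean_ratio (Suc n) \<le> 1 + y * (real n + 1) / (real n + 2 * y)"
    and "0 < x \<Longrightarrow> x \<le> mean_ratio n \<Longrightarrow> 1 + x * (real n + 1) / (real n + 14 / 5 * x) \<le> mean_ratio (Suc n)"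
proof -
  let ?u = "mean_ratio n" and ?r = "p2 (Suc n) / p2 n"
  have u: "?u > 0" by (rule mean_ratio_pos)
  have r: "?r > 0" by (simp add: p2_pos)
  {
    assume "?u \<le> y"
    have "?u / ?r \<le> ?u / ((real n + 2 * ?u) / (real n + 1))"
      using p2_ratio_bounds(1)[of n] u r assms by (intro divide_left_mono) (auto simp: p2_pos add_pos_pos)
    also have "\<dots> = (real n + 1) * (?u / (real n + 2 * ?u))" by simp
    also have "\<dots> \<le> (real n + 1) * (y / (real n + 2 * y))"
      using u \<open>?u \<le> y\<close> by (intro mult_left_mono divide_affine_mono) auto
    finally show "mean_ratio (Suc n) \<le> 1 + y * (real n + 1) / (real n + 2 * y)"
      unfolding mean_ratio_Suc by (simp add: mult.commute)
  }
  {
    assume x: "0 < x" "x \<le> ?u"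
    have "(real n + 1) * (x / (real n + 14 / 5 * x)) \<le> (real n + 1) * (?u / (real n + 14 / 5 * ?u))"
      using x by (intro mult_left_mono divide_affine_mono) auto
    also have "\<dots> = ?u / ((real n + 14 / 5 * ?u) / (real n + 1))" by simp
    also have "\<dots> \<le> ?u / ?r"
      using p2_ratio_bounds(2)[of n] u r assms by (intro divide_left_mono) (auto simp: p2_pos add_pos_pos)
    finally show "1 + x * (real n + 1) / (real n + 14 / 5 * x) \<le> mean_ratio (Suc n)"
      unfolding mean_ratio_Suc by (simp add: mult.commute)
  }
qed

section \<open>Real inequalities for the passage from s = sqrt n to t = sqrt (n + 1)\<close>

lemma upper_step:
  fixes s t :: real
  assumes s: "s \<ge> 6" and t: "t \<ge> 0" "t\<^sup>2 = s\<^sup>2 + 1"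
  defines "y \<equiv> 71 / 100 * s + 7 / 10"
  shows "1 + y * (s\<^sup>2 + 1) / (s\<^sup>2 + 2 * y) \<le> 71 / 100 * t + 7 / 10"
proof -
  \<comment> \<open>The constant 49/100 is slightly below the 1/2 of the first-order expansion,
    which makes this a valid lower bound for \<open>s \<ge> 6\<close>.\<close>
  have t': "s + 49 / (100 * s) \<le> t"
  proof (rule power2_le_imp_le[OF _ t(1)])
    have "6 * 6 \<le> s * s" using s by (intro mult_mono) auto
    then show "(s + 49 / (100 * s))\<^sup>2 \<le> t\<^sup>2"
      unfolding t(2) using s by (simp add: power2_eq_square field_simps)
  qed
  have sq: "s\<^sup>2 \<ge> 6 * s" using s by (simp add: power2_eq_square)
  have "s ^ 3 \<ge> 0" using s by simp
  have pos: "s\<^sup>2 + 2 * y > 0" using s by (simp add: y_def add_nonneg_pos)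
  \<comment> \<open>This is the claim with denominators cleared. Its leading coefficient is
    \<open>2 * (71 / 100)\<^sup>2 - 1\<close>, positive since 71/100 exceeds 1 / sqrt 2.\<close>
  have "0 \<le> 82 / 10000 * s ^ 3 + 2059 / 10000 * s\<^sup>2 - 625982 / 1000000 * s + 48706 / 100000"
    using sq s \<open>s ^ 3 \<ge> 0\<close> by linarith
  then have "y * (s\<^sup>2 + 1) * s \<le> (71 / 100 * s\<^sup>2 - 3 / 10 * s + 3479 / 10000) * (s\<^sup>2 + 2 * y)"
    by (simp add: y_def algebra_simps add_divide_distrib power2_eq_square power3_eq_cube)
  then have "y * (s\<^sup>2 + 1) / (s\<^sup>2 + 2 * y) * s \<le> 71 / 100 * s\<^sup>2 - 3 / 10 * s + 3479 / 10000"
    using pos by (simp add: pos_divide_le_eq)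
  then have "y * (s\<^sup>2 + 1) / (s\<^sup>2 + 2 * y) \<le> (71 / 100 * s\<^sup>2 - 3 / 10 * s + 3479 / 10000) / s"
    using s by (subst pos_le_divide_eq) auto
  also have "\<dots> = 71 / 100 * (s + 49 / (100 * s)) - 3 / 10"
    using s by (simp add: field_simps power2_eq_square)
  also have "71 / 100 * (s + 49 / (100 * s)) \<le> 71 / 100 * t"
    using t' by (rule mult_left_mono) simp
  finally show ?thesis by simp
qed

lemma sqrt_succ_le:
  fixes s t :: real
  assumes s: "s > 0" and t: "t\<^sup>2 = s\<^sup>2 + 1"
  shows "t \<le> s + 1 / (2 * s)"
proof (rule power2_le_imp_le)
  show "t\<^sup>2 \<le> (s + 1 / (2 * s))\<^sup>2"
    using s by (simp add: t power2_sum)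
qed (use s in simp)

lemma lower_step:
  fixes s t :: real
  assumes s: "s \<ge> 6" and t: "t\<^sup>2 = s\<^sup>2 + 1"
  defines "x \<equiv> 59 / 100 * s + 1 / 2"
  shows "59 / 100 * t + 1 / 2 \<le> 1 + x * (s\<^sup>2 + 1) / (s\<^sup>2 + 14 / 5 * x)"
proof -
  have t': "t \<le> s + 1 / (2 * s)" using sqrt_succ_le[OF _ t] s by simp
  have sq: "s\<^sup>2 \<ge> 0" "s ^ 3 \<ge> 0" using s by auto
  have pos: "s\<^sup>2 + 14 / 5 * x > 0" using s by (simp add: x_def add_nonneg_pos)
  \<comment> \<open>Here the leading coefficient is \<open>1 - 14 / 5 * (59 / 100)\<^sup>2\<close>,
    positive since 59/100 lies below sqrt (5/14).\<close>
  have "0 \<le> 2532 / 100000 * s ^ 3 + 295 / 1000 * s\<^sup>2 + 71266 / 100000 * s - 413 / 1000"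
    using sq s by linarith
  then have "(59 / 100 * s\<^sup>2 - 1 / 2 * s + 295 / 1000) * (s\<^sup>2 + 14 / 5 * x) \<le> x * (s\<^sup>2 + 1) * s"
    by (simp add: x_def algebra_simps add_divide_distrib power2_eq_square power3_eq_cube)
  then have "59 / 100 * s\<^sup>2 - 1 / 2 * s + 295 / 1000 \<le> x * (s\<^sup>2 + 1) / (s\<^sup>2 + 14 / 5 * x) * s"
    using pos by (simp add: pos_le_divide_eq)
  then have "(59 / 100 * s\<^sup>2 - 1 / 2 * s + 295 / 1000) / s \<le> x * (s\<^sup>2 + 1) / (s\<^sup>2 + 14 / 5 * x)"
    using s by (subst pos_divide_le_eq) auto
  moreover have "(59 / 100 * s\<^sup>2 - 1 / 2 * s + 295 / 1000) / s = 59 / 100 * (s + 1 / (2 * s)) - 1 / 2"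
    using s by (simp add: field_simps power2_eq_square)
  moreover have "59 / 100 * t \<le> 59 / 100 * (s + 1 / (2 * s))"
    using t' by (rule mult_left_mono) simp
  ultimately show ?thesis by linarith
qed

text \<open>To first order \<open>exp (2 * t)\<close> gains the factor 1 + 1/s, while the ratio
  bound supplies 1 + 1.18/s because \<open>2 * x \<ge> 118 / 100 * s + 1\<close>.\<close>

lemma growth_step:
  fixes s t x :: real
  assumes s: "s \<ge> 6" and t: "t\<^sup>2 = s\<^sup>2 + 1" and x: "59 / 100 * s + 1 / 2 \<le> x"
  shows "exp (2 * t) \<le> exp (2 * s) * ((s\<^sup>2 + 2 * x) / (s\<^sup>2 + 1))"
proof -
  define h where "h = 1 / (2 * s)"
  have h: "0 \<le> h" "h \<le> 1" using s by (auto simp: h_def divide_simps)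
  \<comment> \<open>The facts \<open>s1\<close> to \<open>s4\<close> bound, in Horner form, the
    quintic left after clearing denominators in the polynomial comparison below.\<close>
  have s1: "s * (18 / 100 * s - 3 / 4) \<ge> 6 * (33 / 100)" using s by (intro mult_mono) auto
  have s2: "s * (s * (18 / 100 * s - 3 / 4) - 5 / 4) \<ge> 6 * (73 / 100)"
    using s s1 by (intro mult_mono) auto
  have s3: "s * (s * (s * (18 / 100 * s - 3 / 4) - 5 / 4) - 13 / 16) \<ge> 6 * (35 / 10)"
    using s s2 by (intro mult_mono) auto
  have s4: "s * (s * (s * (s * (18 / 100 * s - 3 / 4) - 5 / 4) - 13 / 16) - 1 / 4) \<ge> 6 * 20"
    using s s3 by (intro mult_mono) auto
  have "t \<le> s + h" using sqrt_succ_le[OF _ t] s by (simp add: h_def)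
  then have "exp (2 * t) \<le> exp (2 * s + 2 * h)" by simp
  also have "\<dots> = exp (2 * s) * (exp h)\<^sup>2"
    by (simp add: exp_add exp_double)
  also have "(exp h)\<^sup>2 \<le> (1 + h + h\<^sup>2)\<^sup>2"
    using exp_bound[OF h] by (intro power_mono) auto
  also have "(1 + h + h\<^sup>2)\<^sup>2 \<le> (s\<^sup>2 + 118 / 100 * s + 1) / (s\<^sup>2 + 1)"
  proof (subst pos_le_divide_eq)
    have "(1 + h + h\<^sup>2) = (s\<^sup>2 + s / 2 + 1 / 4) / s\<^sup>2"
      using s by (simp add: h_def field_simps power2_eq_square)
    then have "(1 + h + h\<^sup>2)\<^sup>2 * (s\<^sup>2 + 1) = ((s\<^sup>2 + s / 2 + 1 / 4)\<^sup>2 * (s\<^sup>2 + 1)) / s ^ 4"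
      by (simp add: power_divide power_mult[symmetric])
    also have "\<dots> \<le> s\<^sup>2 + 118 / 100 * s + 1"
    proof (subst pos_divide_le_eq)
      show "(s\<^sup>2 + s / 2 + 1 / 4)\<^sup>2 * (s\<^sup>2 + 1) \<le> (s\<^sup>2 + 118 / 100 * s + 1) * s ^ 4"
        using s4 by (simp add: algebra_simps add_divide_distrib power2_eq_square eval_nat_numeral)
    qed (use s in simp)
    finally show "(1 + h + h\<^sup>2)\<^sup>2 * (s\<^sup>2 + 1) \<le> s\<^sup>2 + 118 / 100 * s + 1" .
  qed (simp add: add_nonneg_pos)
  also have "\<dots> \<le> (s\<^sup>2 + 2 * x) / (s\<^sup>2 + 1)"
    using x by (intro divide_right_mono) auto
  finally show ?thesis by simp
qed

lemma ratio_le_exp: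
  fixes s y :: real
  assumes s: "s \<ge> 6" and y: "y \<le> 71 / 100 * s + 7 / 10"
  shows "(s\<^sup>2 + 14 / 5 * y) / (s\<^sup>2 + 1) \<le> exp (2 / s)"
proof -
  have "(s\<^sup>2 + 14 / 5 * y) / (s\<^sup>2 + 1) \<le> 1 + 2 / s + (2 / s)\<^sup>2 / 2"
  proof (subst pos_divide_le_eq)
    \<comment> \<open>The product 14/5 * 71/100 = 1.988 stays below 2, which permits the exponent
      \<open>2 / s\<close>.\<close>
    have "s\<^sup>2 + 14 / 5 * y \<le> s\<^sup>2 + 2 * s + 3" using s y by simp
    also have "\<dots> \<le> (1 + 2 / s + (2 / s)\<^sup>2 / 2) * (s\<^sup>2 + 1)"
      using s by (simp add: field_simps power2_eq_square)
    finally show "s\<^sup>2 + 14 / 5 * y \<le> (1 + 2 / s + (2 / s)\<^sup>2 / 2) * (s\<^sup>2 + 1)" .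
  qed (simp add: add_nonneg_pos)
  also have "\<dots> \<le> exp (2 / s)" using s by (intro exp_lower_Taylor_quadratic) simp
  finally show ?thesis .
qed

section \<open>Growth from index 36 on\<close>

lemma p2_nth_upt: "n < 37 \<Longrightarrow> p2 n = map p2 [0..<37] ! n"
  by (simp del: upt_rec_numeral)

lemma p2_eval: "p2 (Suc 0) = 2" "p2 2 = 4" "p2 3 = 8" "p2 4 = 14" "p2 36 = 504886"
  using p2_nth_upt[of "Suc 0"] p2_nth_upt[of 2] p2_nth_upt[of 3] p2_nth_upt[of 4] p2_nth_upt[of 36]
  unfolding p2_table by simp_all

text \<open>The two bounds on \<open>mean_ratio\<close> each propagate on their own; the lower one
  also drives the exponential growth.\<close>

lemma mean_ratio_growth:
  assumes "n \<ge> 36"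
  shows "59 / 100 * sqrt n + 1 / 2 \<le> mean_ratio n \<and> mean_ratio n \<le> 71 / 100 * sqrt n + 7 / 10
    \<and> exp (2 * sqrt n) < p2 n"
  using assms
proof (induction n rule: dec_induct)
  case base
  have sqrt: "sqrt 36 = 6" by (rule real_sqrt_unique) auto
  have "p2_sum 36 = sum_list (map p2 [0..<37])"
    by (simp only: p2_sum_def interv_sum_list_conv_sum_set_nat atLeast0LessThan)
      (rule sum.cong, auto)
  also have "\<dots> = 2298873" unfolding p2_table by simp
  finally have "mean_ratio 36 = 2298873 / 504886" by (simp add: mean_ratio_def p2_eval)
  moreover have "exp (2 * 6) = exp (1 :: real) ^ 12"
    by (simp add: exp_of_nat_mult[symmetric])
  moreover have "exp (1 :: real) ^ 12 < (272 / 100) ^ 12"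
    using e_less_272 by (intro power_strict_mono) auto
  ultimately show ?case by (simp add: sqrt p2_eval power_divide)
next
  case (step n)
  define s where "s = sqrt n"
  define t where "t = sqrt (Suc n)"
  have s: "s \<ge> 6" unfolding s_def using step.hyps by (intro real_le_rsqrt) simp
  have n: "real n = s\<^sup>2" by (simp add: s_def)
  have t: "t \<ge> 0" "t\<^sup>2 = s\<^sup>2 + 1" by (simp_all add: s_def t_def)
  have IH: "59 / 100 * s + 1 / 2 \<le> mean_ratio n" "mean_ratio n \<le> 71 / 100 * s + 7 / 10"
    "exp (2 * s) < p2 n"
    using step.IH by (simp_all add: s_def)
  have "n > 0" using step.hyps by simp
  have lower: "59 / 100 * t + 1 / 2 \<le> mean_ratio (Suc n)"
  proof (rule order_trans)
    show "59 / 100 * t + 1 / 2 \<le> 1 + (59 / 100 * s + 1 / 2) * (s\<^sup>2 + 1) / (s\<^sup>2 + 14 / 5 * (59 / 100 * s + 1 / 2))"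
      by (rule lower_step[OF s t(2)])
    show "\<dots> \<le> mean_ratio (Suc n)"
      using mean_ratio_Suc_bounds(2)[OF \<open>n > 0\<close> _ IH(1)] s unfolding n by simp
  qed
  have upper: "mean_ratio (Suc n) \<le> 71 / 100 * t + 7 / 10"
    using upper_step[OF s t] mean_ratio_Suc_bounds(1)[OF \<open>n > 0\<close> IH(2)]
    unfolding n by (rule order_trans[rotated])
  have "exp (2 * t) \<le> exp (2 * s) * ((s\<^sup>2 + 2 * mean_ratio n) / (s\<^sup>2 + 1))"
    by (rule growth_step[OF s t(2) IH(1)])
  also have "\<dots> \<le> exp (2 * s) * (p2 (Suc n) / p2 n)"
    using p2_ratio_bounds(1)[of n] unfolding n by (intro mult_left_mono) auto
  also have "\<dots> < p2 n * (p2 (Suc n) / p2 n)"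
    using IH(3) by (intro mult_strict_right_mono) (auto simp: p2_pos)
  also have "\<dots> = p2 (Suc n)" using p2_pos[of n] by simp
  finally show ?case using lower upper by (simp add: t_def)
qed

lemma p2_power_less_large:
  assumes "n \<ge> 36"
  shows "p2 (Suc n) ^ n < p2 n ^ Suc n"
proof -
  define s where "s = sqrt n"
  have s: "s \<ge> 6" unfolding s_def using assms by (intro real_le_rsqrt) simp
  have n: "real n = s\<^sup>2" by (simp add: s_def)
  have "p2 (Suc n) / p2 n \<le> (real n + 14 / 5 * mean_ratio n) / (real n + 1)"
    by (rule p2_ratio_bounds)
  also have "\<dots> \<le> exp (2 / s)"
    unfolding n using mean_ratio_growth[OF assms] by (intro ratio_le_exp s) (simp add: s_def)
  finally have "p2 (Suc n) \<le> exp (2 / s) * p2 n"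
    using p2_pos[of n] by (simp add: pos_divide_le_eq)
  then have "p2 (Suc n) ^ n \<le> (exp (2 / s) * p2 n) ^ n"
    using p2_pos[of "Suc n"] by (intro power_mono) auto
  also have "\<dots> = exp (real n * (2 / s)) * p2 n ^ n"
    by (simp only: power_mult_distrib exp_of_nat_mult)
  also have "real n * (2 / s) = 2 * s" unfolding n using s by (simp add: power2_eq_square)
  \<comment> \<open>The n-th power of the ratio costs at most \<open>exp (2 * s)\<close>, which the
    single extra factor \<open>p2 n\<close> exceeds.\<close>
  also have "exp (2 * s) * p2 n ^ n < p2 n * p2 n ^ n"
    using mean_ratio_growth[OF assms] p2_pos[of n]
    by (intro mult_strict_right_mono) (auto simp: s_def)
  finally show ?thesis by simp
qed

section \<open>Indices below 36 by log-concavity\<close>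

lemma log_concave_power_step:
  fixes a b c :: real
  assumes "a > 0" "b > 0" "c > 0" "a * c \<le> b\<^sup>2" "b ^ n < a ^ Suc n"
  shows "c ^ Suc n < b ^ Suc (Suc n)"
proof -
  \<comment> \<open>The common factor \<open>b ^ n\<close> allows \<open>a\<close> and
    \<open>c\<close> to be merged into \<open>a * c \<le> b\<^sup>2\<close>, and is cancelled at the
    end.\<close>
  have "b ^ n * c ^ Suc n < a ^ Suc n * c ^ Suc n"
    using assms by (intro mult_strict_right_mono) auto
  also have "\<dots> = (a * c) ^ Suc n" by (simp only: power_mult_distrib)
  also have "\<dots> \<le> (b\<^sup>2) ^ Suc n" using assms by (intro power_mono) auto
  also have "\<dots> = b ^ n * b ^ Suc (Suc n)"
    by (simp only: power_mult[symmetric] power_add[symmetric]) (rule arg_cong[where f = "\<lambda>k. b ^ k"], simp)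
  finally show ?thesis using assms by (simp only: mult_less_cancel_left_pos zero_less_power)
qed

lemma p2_log_concave_small:
  assumes "n \<le> 34"
  shows "p2 n * p2 (Suc (Suc n)) \<le> (p2 (Suc n))\<^sup>2"
proof -
  let ?ps = "map p2 [0..<37]"
  have "\<forall>i\<in>set [0..<35]. ?ps ! i * ?ps ! (i + 2) \<le> (?ps ! (i + 1))\<^sup>2"
    unfolding p2_table
    by (simp add: upt_rec[of 0 "numeral n" for n] upt_rec[of "Suc 0" "numeral n" for n]
      numeral_2_eq_2[symmetric] del: set_upt)
  moreover have "n \<in> set [0..<35]" using assms by (simp only: set_upt) simp
  ultimately have "?ps ! n * ?ps ! (n + 2) \<le> (?ps ! (n + 1))\<^sup>2" by blast
  with assms show ?thesis by (simp del: upt_rec_numeral)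
qed

lemma p2_power_less:
  assumes "n \<ge> 3"
  shows "p2 (Suc n) ^ n < p2 n ^ Suc n"
proof (cases "n \<ge> 36")
  case False
  from assms False show ?thesis
  proof (induction n rule: dec_induct)
    \<comment> \<open>The induction starts from 14^3 = 2744 < 4096 = 8^4.\<close>
    case base
    then show ?case by (simp add: p2_eval)
  next
    case (step n)
    then show ?case
      by (intro log_concave_power_step[OF p2_pos p2_pos p2_pos p2_log_concave_small]) auto
  qed
qed (rule p2_power_less_large)

theorem theorem1p5:
  shows "((\<lambda>m. (1 + fps_X ^ Suc m) / (1 - fps_X ^ Suc m)) has_prod
           (Abs_fps (\<lambda>n. real (pbar n)))) \<and>
         (\<forall>n. real (pbar n) = poly (P_poly n) 2) \<and>
         Delta 1 2 = 0 \<and> Delta 2 2 = 0 \<and>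
         (\<forall>n\<ge>3. pbar n ^ (n + 1) > pbar (n + 1) ^ n) \<and>
         (\<forall>n\<ge>3. Delta n 2 > 0)"
proof (intro conjI allI impI)
  show "(\<lambda>m. (1 + fps_X ^ Suc m) / (1 - fps_X ^ Suc m)) has_prod (Abs_fps (\<lambda>n. real (pbar n)))"
    by (rule has_prod_pbar)
  show "real (pbar n) = poly (P_poly n) 2" for n
    by (simp add: pbar_eq_p2 p2_def)
  have Delta: "Delta n 2 = p2 n ^ Suc n - p2 (Suc n) ^ n" for n
    by (simp add: Delta_def p2_def del: P_poly.simps)
  \<comment> \<open>The equality cases are 2^2 = 4 and 4^3 = 8^2.\<close>
  show "Delta 1 2 = 0" "Delta 2 2 = 0"
    using Delta[of 1] Delta[of 2] p2_eval by (simp_all add: numeral_2_eq_2 numeral_3_eq_3)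
  fix n :: nat
  assume n: "n \<ge> 3"
  show "Delta n 2 > 0" using p2_power_less[OF n] by (simp add: Delta)
  have "real (pbar (n + 1) ^ n) < real (pbar n ^ (n + 1))"
    using p2_power_less[OF n] by (simp add: pbar_eq_p2)
  then show "pbar n ^ (n + 1) > pbar (n + 1) ^ n" by (simp only: of_nat_less_iff)
qed

end
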